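(* The Hartogs triangle $\mathbf{T}=\{(z,w)\in\mathbf{C}^2 : |z|<|w|<1\}$ has Ahlfors-David regular boundary; that is, its boundary $b\mathbf{T}\subset\mathbf{C}^2\cong\mathbf{R}^4$ is Ahlfors-David regular.
   Context: Let $\sigma$ be the $(d-1)$-dimensional Hausdorff measure on $\mathbf{R}^d$ and let $B_\rho(p)$ be the ball of radius $\rho$ about $p$. A closed subset $S\subset\mathbf{R}^d$ is Ahlfors-David regular if there is a constant $c>0$ such that $c^{-1}\rho^{d-1}\le\sigma(B_\rho(p)\cap S)\le c\,\rho^{d-1}$ for all $p\in S$ and all $0<\rho<\mathrm{diam}\,S$. Here $d=4$. *)

theory Defs
  imports "HOL-Analysis.Analysis"
begin

text \<open>
  Hausdorff measure of integer dimension k, as an outer measure on all subsets. The factor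
  \<open>unit_ball_vol k / 2 ^ k\<close> is the usual normalization for which the k-dimensional measure on a
  k-dimensional Euclidean space is Lebesgue measure. Empty sets in a cover contribute 0, also
  for k = 0 (where \<open>0 ^ 0 = 1\<close> in HOL), so countable covers include finite ones.
  Boundedness is required explicitly because \<open>diameter\<close> is real-valued and carries no
  information on unbounded sets.
\<close>

definition hausdorff_pre :: "nat \<Rightarrow> real \<Rightarrow> 'a::metric_space set \<Rightarrow> ennreal" where
  "hausdorff_pre k \<delta> A =
     (INF U \<in> {U :: nat \<Rightarrow> 'a set.
                 A \<subseteq> (\<Union>i. U i) \<and> (\<forall>i. bounded (U i) \<and> diameter (U i) \<le> \<delta>)}.
        \<Sum>i. if U i = {} then 0
             else ennreal (unit_ball_vol (real k) * (diameter (U i) / 2) ^ k))"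

definition hausdorff_measure :: "nat \<Rightarrow> 'a::metric_space set \<Rightarrow> ennreal" where
  "hausdorff_measure k A = (SUP \<delta> \<in> {0<..}. hausdorff_pre k \<delta> A)"

text \<open>
  Balls are open. The condition \<open>\<rho> < diam S\<close> is void for unbounded S, where the diameter is
  infinite (the real-valued \<open>diameter\<close> does not express this).
\<close>

definition ahlfors_david_regular :: "'a::euclidean_space set \<Rightarrow> bool" where
  "ahlfors_david_regular S \<longleftrightarrow>
     closed S \<and>
     (\<exists>c::real. c > 0 \<and>
        (\<forall>p\<in>S. \<forall>\<rho>::real. 0 < \<rho> \<longrightarrow> (bounded S \<longrightarrow> \<rho> < diameter S) \<longrightarrow>
           ennreal (inverse c * \<rho> ^ (DIM('a) - 1)) \<le> hausdorff_measure (DIM('a) - 1) (ball p \<rho> \<inter> S) \<and>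
           hausdorff_measure (DIM('a) - 1) (ball p \<rho> \<inter> S) \<le> ennreal (c * \<rho> ^ (DIM('a) - 1))))"

text \<open>
  The product type \<open>complex \<times> complex\<close> carries the Euclidean norm and has real dimension 4,
  so it is isometric to \<open>\<real>\<^sup>4\<close>.
\<close>

definition hartogs_triangle :: "(complex \<times> complex) set" where
  "hartogs_triangle = {(z, w). norm z < norm w \<and> norm w < 1}"

end

theory Submission
  imports Defs
begin

text \<open>
  The boundary of the Hartogs triangle is the union of the cone \<open>norm z = norm w \<le> 1\<close> and the solid
  torus \<open>norm z \<le> 1 = norm w\<close>. Up to exchanging the coordinates, each of the two has the form
  \<open>norm u = \<phi> v\<close>, \<open>norm v \<le> 1\<close> with a 1-Lipschitz function \<open>\<phi>\<close> (the modulus or the constant 1), so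
  both are treated at once.

  For a unit complex number \<open>\<alpha>\<close> write \<open>u = \<alpha> (y + \<i> x)\<close>. Forgetting \<open>y\<close> is a projection to three
  real dimensions, called the shadow below. It is 1-Lipschitz everywhere, so Hausdorff measure
  dominates the Lebesgue measure of the shadow up to a constant (\<open>hausdorff_measure_ge_ball\<close>). On the
  sector \<open>y \<ge> \<bar>x\<bar>\<close> the relation \<open>x\<^sup>2 + y\<^sup>2 = (\<phi> v)\<^sup>2\<close> determines \<open>y\<close> as a Lipschitz function of
  \<open>(v, x)\<close>, so that the projection distorts distances by at most a constant there
  (\<open>dist_le_dist_shadow\<close>); four such sectors cover the plane.

  The upper bound follows by pulling back cubical grids from the shadows of these finitely many
  pieces (\<open>hausdorff_measure_le_pieces\<close>). For the lower bound at a boundary point, choose \<open>\<alpha>\<close>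
  so that \<open>x = 0\<close> there. It suffices that the shadow of the boundary within distance \<open>\<rho>\<close> contains
  a ball of radius comparable to \<open>\<rho>\<close> (\<open>ball_subset_shadow\<close>). Its centre is found by moving \<open>v\<close>
  by an amount of order \<open>\<rho>\<close> away from the edge \<open>norm v = 1\<close> and, on the cone, also away from the
  apex.
\<close>

section \<open>Bounds for Hausdorff measure from maps to Euclidean space\<close>

text \<open>
  A set of diameter \<open>d\<close> has its image under a 1-Lipschitz map inside a ball of radius \<open>d\<close>, whose
  volume exceeds the contribution \<open>unit_ball_vol k * (d / 2) ^ k\<close> of the set to a cover by the factor
  \<open>2 ^ k\<close>. Countable subadditivity of Lebesgue measure then bounds every cover from below; the
  halved radius in the statement accounts for the factor.
\<close>

lemma hausdorff_measure_ge_ball: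
  fixes f :: "'a::metric_space \<Rightarrow> 'b::euclidean_space"
  assumes lip: "\<And>x y. dist (f x) (f y) \<le> dist x y"
    and r: "0 \<le> r" and sub: "ball q r \<subseteq> f ` A"
  shows "ennreal (unit_ball_vol (real DIM('b)) * (r / 2) ^ DIM('b)) \<le> hausdorff_measure DIM('b) A"
proof -
  let ?k = "DIM('b)" and ?v = "unit_ball_vol (real DIM('b))"
  have "ennreal (?v * (r / 2) ^ ?k) \<le> hausdorff_pre ?k 1 A"
    unfolding hausdorff_pre_def
  proof (rule INF_greatest)
    fix U :: "nat \<Rightarrow> 'a set"
    assume "U \<in> {U. A \<subseteq> (\<Union>i. U i) \<and> (\<forall>i. bounded (U i) \<and> diameter (U i) \<le> 1)}"
    then have cov: "A \<subseteq> (\<Union>i. U i)" and bdd: "\<And>i. bounded (U i)" by auto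
    define x where "x i = (SOME x. x \<in> U i)" for i
    have x: "x i \<in> U i" if "U i \<noteq> {}" for i
      using that unfolding x_def by (simp add: some_in_eq)
    define C where "C i = (if U i = {} then {} else cball (f (x i)) (diameter (U i)))" for i
    have "ball q r \<subseteq> (\<Union>i. C i)"
    proof
      fix y assume "y \<in> ball q r"
      then obtain a where a: "a \<in> A" "y = f a" using sub by auto
      then obtain i where i: "a \<in> U i" using cov by auto
      then have "U i \<noteq> {}" by auto
      then have "dist (x i) a \<le> diameter (U i)"
        using x i bdd diameter_bounded_bound by blast
      then have "y \<in> C i" using a i lip[of "x i" a] by (auto simp: C_def)
      then show "y \<in> (\<Union>i. C i)" by auto
    qed
    then have "emeasure lborel (ball q r) \<le> emeasure lborel (\<Union>i. C i)"
      by (intro emeasure_mono) (auto simp: C_def)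
    also have "\<dots> \<le> (\<Sum>i. emeasure lborel (C i))"
      by (intro emeasure_subadditive_countably) (auto simp: C_def)
    also have "\<dots> = (\<Sum>i. ennreal (2 ^ ?k) * (if U i = {} then 0
                   else ennreal (?v * (diameter (U i) / 2) ^ ?k)))"
      using diameter_ge_0[OF bdd]
      by (intro suminf_cong)
        (auto simp: C_def emeasure_cball power_divide ennreal_mult''[symmetric])
    also have "\<dots> = ennreal (2 ^ ?k) * (\<Sum>i. if U i = {} then 0
                   else ennreal (?v * (diameter (U i) / 2) ^ ?k))" (is "_ = _ * ?s")
      by (rule ennreal_suminf_cmult)
    finally have main: "ennreal (?v * r ^ ?k) \<le> ennreal (2 ^ ?k) * ?s"
      using r by (simp add: emeasure_ball)
    have "ennreal (?v * (r / 2) ^ ?k) = ennreal (1 / 2 ^ ?k) * ennreal (?v * r ^ ?k)"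
      using r by (subst ennreal_mult[symmetric]) (auto simp: power_divide)
    also have "\<dots> \<le> ennreal (1 / 2 ^ ?k) * (ennreal (2 ^ ?k) * ?s)"
      using main by (rule mult_left_mono) auto
    also have "\<dots> = ?s"
      by (subst mult.assoc[symmetric], subst ennreal_mult[symmetric]) auto
    finally show "ennreal (?v * (r / 2) ^ ?k) \<le> ?s" .
  qed
  also have "\<dots> \<le> hausdorff_measure ?k A"
    unfolding hausdorff_measure_def by (rule SUP_upper) auto
  finally show ?thesis .
qed

lemma hausdorff_pre_le_finite_cover:
  fixes U :: "'i \<Rightarrow> 'a::metric_space set"
  assumes fin: "finite I" and cov: "A \<subseteq> (\<Union>i\<in>I. U i)"
    and bdd: "\<And>i. i \<in> I \<Longrightarrow> bounded (U i)"
    and diam: "\<And>i. i \<in> I \<Longrightarrow> diameter (U i) \<le> \<epsilon>"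
    and eps: "0 \<le> \<epsilon>" "\<epsilon> \<le> \<delta>"
  shows "hausdorff_pre k \<delta> A \<le> ennreal (real (card I) * (unit_ball_vol (real k) * (\<epsilon> / 2) ^ k))"
proof -
  obtain h where h: "bij_betw h {..<card I} I"
    using ex_bij_betw_nat_finite[OF fin] by (auto simp: atLeast0LessThan)
  define V where "V n = (if n < card I then U (h n) else {})" for n
  have hI: "h n \<in> I" if "n < card I" for n
    using h that by (auto simp: bij_betw_def)
  have "A \<subseteq> (\<Union>n. V n)"
  proof
    fix a assume "a \<in> A"
    then obtain i where i: "i \<in> I" "a \<in> U i" using cov by auto
    then have "i \<in> h ` {..<card I}" using bij_betw_imp_surj_on[OF h] by simp
    then obtain n where "n < card I" "h n = i" by blast
    then show "a \<in> (\<Union>n. V n)" using i by (auto simp: V_def)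
  qed
  moreover have "bounded (V n) \<and> diameter (V n) \<le> \<delta>" for n
  proof (cases "n < card I")
    case True
    then show ?thesis using hI[OF True] bdd[of "h n"] diam[of "h n"] eps by (auto simp: V_def)
  next
    case False
    then show ?thesis using eps by (simp add: V_def)
  qed
  ultimately have "hausdorff_pre k \<delta> A \<le> (\<Sum>n. if V n = {} then 0
             else ennreal (unit_ball_vol (real k) * (diameter (V n) / 2) ^ k))" (is "_ \<le> suminf ?t")
    unfolding hausdorff_pre_def by (intro INF_lower) auto
  also have "\<dots> = (\<Sum>n<card I. ?t n)"
    by (rule suminf_finite) (auto simp: V_def)
  also have "\<dots> \<le> (\<Sum>n<card I. ennreal (unit_ball_vol (real k) * (\<epsilon> / 2) ^ k))"
  proof (rule sum_mono)
    fix n assume "n \<in> {..<card I}"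
    then have n: "n < card I" by simp
    show "?t n \<le> ennreal (unit_ball_vol (real k) * (\<epsilon> / 2) ^ k)"
      using diam[OF hI[OF n]] diameter_ge_0[OF bdd[OF hI[OF n]]] n
      by (auto simp: V_def intro!: ennreal_leI mult_left_mono power_mono divide_right_mono)
  qed
  also have "\<dots> = ennreal (real (card I) * (unit_ball_vol (real k) * (\<epsilon> / 2) ^ k))"
    using eps by (simp add: ennreal_mult ennreal_of_nat_eq_real_of_nat)
  finally show ?thesis .
qed

text \<open>
  A grid of \<open>n ^ k\<close> cells of side \<open>2 * \<rho> / n\<close> on the cube that contains the image of a piece pulls
  back to sets of diameter \<open>O(\<rho> / n)\<close>, because the map does not contract by more than the factor
  \<open>K\<close>. The sum of the \<open>k\<close>-th powers of these diameters does not depend on \<open>n\<close>, while the mesh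
  becomes arbitrarily fine. Different pieces may use different maps.
\<close>

lemma hausdorff_measure_le_pieces:
  fixes f :: "'j \<Rightarrow> 'a::metric_space \<Rightarrow> 'b::euclidean_space"
  assumes fin: "finite J" and cov: "A \<subseteq> (\<Union>j\<in>J. P j)"
    and expand: "\<And>j x y. j \<in> J \<Longrightarrow> x \<in> P j \<Longrightarrow> y \<in> P j \<Longrightarrow> dist x y \<le> K * dist (f j x) (f j y)"
    and img: "\<And>j x. j \<in> J \<Longrightarrow> x \<in> P j \<Longrightarrow> dist (f j x) (q j) \<le> \<rho>"
    and pos: "0 \<le> K" "0 < \<rho>"
  shows "hausdorff_measure DIM('b) A
     \<le> ennreal (real (card J) * (unit_ball_vol (real DIM('b)) * (K * real DIM('b) * \<rho>) ^ DIM('b)))"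
  unfolding hausdorff_measure_def
proof (rule SUP_least)
  fix \<delta> :: real assume "\<delta> \<in> {0<..}"
  then have \<delta>: "0 < \<delta>" by simp
  let ?k = "DIM('b)"
  define D where "D = 2 * (K * real ?k * \<rho>)"
  have D: "0 \<le> D" using pos by (simp add: D_def)
  obtain n :: nat where n: "0 < n" "D / real n \<le> \<delta>"
  proof -
    obtain n :: nat where "D / \<delta> < real n" using reals_Archimedean2 by blast
    moreover have "0 \<le> D / \<delta>" using D \<delta> by simp
    ultimately have "0 < n" by (auto intro!: gr0I)
    with \<open>D / \<delta> < real n\<close> have "0 < n" "D / real n \<le> \<delta>"
      using \<delta> by (simp_all add: field_simps)
    then show ?thesis using that by blast
  qed
  \<comment> \<open>The minimum puts the points on the far face of the cube into the last of the \<open>n\<close> layers.\<close>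
  define cell where "cell j x b = min (n - 1) (nat \<lfloor>((f j x - q j) \<bullet> b + \<rho>) * n / (2 * \<rho>)\<rfloor>)" for j x b
  define U where "U = (\<lambda>(j, g). {x \<in> P j. \<forall>b\<in>Basis. cell j x b = g b})"
  define I where "I = J \<times> ((Basis::'b set) \<rightarrow>\<^sub>E {..<n})"
  have finI: "finite I" 
    unfolding I_def by (intro finite_cartesian_product finite_PiE fin) auto
  have cardI: "card I = card J * n ^ ?k"
    by (simp add: I_def card_cartesian_product card_PiE)
  have covI: "A \<subseteq> (\<Union>i\<in>I. U i)"
  proof
    fix a assume "a \<in> A"
    then obtain j where j: "j \<in> J" "a \<in> P j" using cov by auto
    have "(j, restrict (cell j a) Basis) \<in> I" "a \<in> U (j, restrict (cell j a) Basis)"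
      using j n by (auto simp: I_def U_def cell_def)
    then show "a \<in> (\<Union>i\<in>I. U i)" by blast
  qed
  have cell: "real (cell j x b) \<le> ((f j x - q j) \<bullet> b + \<rho>) * n / (2 * \<rho>)
      \<and> ((f j x - q j) \<bullet> b + \<rho>) * n / (2 * \<rho>) \<le> real (cell j x b) + 1"
    if "j \<in> J" "x \<in> P j" "b \<in> Basis" for j x b
  proof -
    let ?s = "((f j x - q j) \<bullet> b + \<rho>) * n / (2 * \<rho>)"
    have "\<bar>(f j x - q j) \<bullet> b\<bar> \<le> \<rho>"
      using Basis_le_norm[OF that(3), of "f j x - q j"] img[OF that(1,2)] by (simp add: dist_norm)
    then have b: "0 \<le> (f j x - q j) \<bullet> b + \<rho>" "(f j x - q j) \<bullet> b + \<rho> \<le> 2 * \<rho>" by auto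
    have s0: "0 \<le> ?s" using b pos by simp
    have "((f j x - q j) \<bullet> b + \<rho>) * n \<le> (2 * \<rho>) * n"
      using b by (intro mult_right_mono) auto
    then have sn: "?s \<le> n" using pos by (simp add: field_simps)
    show ?thesis using s0 sn n unfolding cell_def by linarith
  qed
  have dist_U: "dist x y \<le> D / n" if iI: "i \<in> I" and xyU: "x \<in> U i" "y \<in> U i" for i x y
  proof -
    obtain j g where i: "i = (j, g)" "j \<in> J" using iI by (auto simp: I_def)
    have xy: "x \<in> P j" "y \<in> P j" and eq: "\<And>b. b \<in> Basis \<Longrightarrow> cell j x b = cell j y b"
      using xyU i by (auto simp: U_def)
    have co: "\<bar>(f j x - f j y) \<bullet> b\<bar> \<le> 2 * \<rho> / n" if b: "b \<in> Basis" for b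
    proof -
      have "\<bar>((f j x - q j) \<bullet> b + \<rho>) * n / (2 * \<rho>) - ((f j y - q j) \<bullet> b + \<rho>) * n / (2 * \<rho>)\<bar> \<le> 1"
        using cell[OF i(2) xy(1) b] cell[OF i(2) xy(2) b] eq[OF b] by linarith
      moreover have "((f j x - q j) \<bullet> b + \<rho>) * n / (2 * \<rho>) - ((f j y - q j) \<bullet> b + \<rho>) * n / (2 * \<rho>)
          = ((f j x - f j y) \<bullet> b) * (n / (2 * \<rho>))"
        using pos by (simp add: field_simps inner_diff_left)
      ultimately have "\<bar>(f j x - f j y) \<bullet> b\<bar> * (n / (2 * \<rho>)) \<le> 1"
        using pos n by (simp add: abs_mult)
      then show ?thesis using pos n by (simp add: field_simps)
    qed
    have "dist (f j x) (f j y) \<le> (\<Sum>b\<in>Basis. \<bar>(f j x - f j y) \<bullet> b\<bar>)"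
      unfolding dist_norm by (rule norm_le_l1)
    also have "\<dots> \<le> (\<Sum>b\<in>(Basis::'b set). 2 * \<rho> / n)" by (rule sum_mono) (rule co)
    also have "\<dots> = real ?k * (2 * \<rho> / n)" by simp
    finally have "K * dist (f j x) (f j y) \<le> K * (real ?k * (2 * \<rho> / n))"
      using pos by (intro mult_left_mono)
    then show ?thesis using expand[OF i(2) xy] by (simp add: D_def algebra_simps)
  qed
  have bddU: "bounded (U i)" if "i \<in> I" for i
    using dist_U[OF that] unfolding bounded_def by (cases "U i = {}") blast+
  have diamU: "diameter (U i) \<le> D / n" if "i \<in> I" for i
  proof (cases "U i = {}")
    case False
    then show ?thesis using dist_U[OF that]
      by (auto simp: diameter_def intro!: cSUP_least)
  qed (use D in simp)
  have "hausdorff_pre ?k \<delta> A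
      \<le> ennreal (real (card I) * (unit_ball_vol (real ?k) * (D / n / 2) ^ ?k))"
    by (rule hausdorff_pre_le_finite_cover[OF finI covI bddU diamU]) (use D n in auto)
  also have "real (card I) * (unit_ball_vol (real ?k) * (D / n / 2) ^ ?k)
      = real (card J) * (unit_ball_vol (real ?k) * (K * real ?k * \<rho>) ^ ?k)"
    using n by (simp add: cardI D_def power_divide)
  finally show "hausdorff_pre ?k \<delta> A
      \<le> ennreal (real (card J) * (unit_ball_vol (real ?k) * (K * real ?k * \<rho>) ^ ?k))" .
qed

section \<open>Graphs of the modulus of one complex coordinate over the other\<close>

lemma complex_polar:
  fixes w :: complex
  obtains \<beta> where "norm \<beta> = 1" "w = \<beta> * of_real (norm w)"
proof (cases "w = 0")
  case True
  then show ?thesis by (intro that[of 1]) simp_all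
next
  case False
  then have "norm (sgn w) = 1" "w = sgn w * of_real (norm w)"
    by (simp_all add: norm_sgn) (simp add: sgn_eq)
  then show ?thesis by (rule that)
qed

definition radial_graph :: "(complex \<Rightarrow> real) \<Rightarrow> (complex \<times> complex) set" where
  "radial_graph \<phi> = {(u, v). norm u = \<phi> v \<and> norm v \<le> 1}"

text \<open>
  If \<open>\<alpha>\<close> is a unit and \<open>u = \<alpha> * Complex y x\<close>, the shadow of \<open>(u, v)\<close> is \<open>(v, x)\<close>, and \<open>u\<close> lies in the
  sector of \<open>\<alpha>\<close> if \<open>\<bar>x\<bar> \<le> y\<close>, which is the quarter plane around the direction \<open>\<alpha>\<close>.
\<close>

definition shadow :: "complex \<Rightarrow> complex \<times> complex \<Rightarrow> complex \<times> real" where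
  "shadow \<alpha> p = (snd p, Im (cnj \<alpha> * fst p))"

definition sector :: "complex \<Rightarrow> complex set" where
  "sector \<alpha> = {u. \<bar>Im (cnj \<alpha> * u)\<bar> \<le> Re (cnj \<alpha> * u)}"

lemma dist_shadow_le:
  assumes "norm \<alpha> = 1"
  shows "dist (shadow \<alpha> p) (shadow \<alpha> q) \<le> dist p q"
proof -
  have "\<bar>Im (cnj \<alpha> * (fst p - fst q))\<bar> \<le> norm (fst p - fst q)"
    using abs_Im_le_cmod[of "cnj \<alpha> * (fst p - fst q)"] assms by (simp add: norm_mult)
  then have "dist (Im (cnj \<alpha> * fst p)) (Im (cnj \<alpha> * fst q)) \<le> dist (fst p) (fst q)"
    by (simp add: dist_norm algebra_simps)
  then have "(dist (Im (cnj \<alpha> * fst p)) (Im (cnj \<alpha> * fst q)))\<^sup>2 \<le> (dist (fst p) (fst q))\<^sup>2"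
    by (intro power_mono) auto
  then show ?thesis by (simp add: shadow_def dist_prod_def)
qed

lemma sector_cover: "\<exists>\<alpha>\<in>{1, \<i>, -1, -\<i>}. u \<in> sector \<alpha>"
proof -
  consider "\<bar>Im u\<bar> \<le> Re u" | "\<bar>Re u\<bar> \<le> Im u" | "\<bar>Im u\<bar> \<le> - Re u" | "\<bar>Re u\<bar> \<le> - Im u"
    by linarith
  then show ?thesis by cases (simp_all add: sector_def)
qed

text \<open>
  Factor \<open>(Re a)\<^sup>2 - (Re b)\<^sup>2\<close>, rewritten through moduli and imaginary parts, and cancel \<open>Re a + Re b\<close>:
  in the sector this sum dominates \<open>\<bar>Im a + Im b\<bar>\<close> and, up to the factor 2, \<open>norm a + norm b\<close>.
\<close>

lemma diff_Re_sector_le: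
  fixes a b :: complex
  assumes "\<bar>Im a\<bar> \<le> Re a" "\<bar>Im b\<bar> \<le> Re b"
  shows "\<bar>Re a - Re b\<bar> \<le> \<bar>Im a - Im b\<bar> + 2 * \<bar>norm a - norm b\<bar>"
proof (cases "Re a + Re b = 0")
  case True
  then have "Re a = 0" "Re b = 0" using assms by linarith+
  then show ?thesis by simp
next
  case False
  then have s: "0 < Re a + Re b" using assms by linarith
  have na: "norm a \<le> 2 * Re a" and nb: "norm b \<le> 2 * Re b"
    using cmod_le[of a] cmod_le[of b] assms by linarith+
  have "(Re a - Re b) * (Re a + Re b)
      = (norm a - norm b) * (norm a + norm b) - (Im a - Im b) * (Im a + Im b)"
    using cmod_power2[of a] cmod_power2[of b] by (simp add: algebra_simps power2_eq_square)
  then have "\<bar>Re a - Re b\<bar> * (Re a + Re b)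
      \<le> \<bar>norm a - norm b\<bar> * (norm a + norm b) + \<bar>Im a - Im b\<bar> * \<bar>Im a + Im b\<bar>"
    using s abs_triangle_ineq4[of "(norm a - norm b) * (norm a + norm b)" "(Im a - Im b) * (Im a + Im b)"]
    by (simp add: abs_mult[symmetric]) (simp add: abs_mult)
  also have "\<dots> \<le> \<bar>norm a - norm b\<bar> * (2 * (Re a + Re b)) + \<bar>Im a - Im b\<bar> * (Re a + Re b)"
    using na nb assms by (intro add_mono mult_left_mono) auto
  also have "\<dots> = (\<bar>Im a - Im b\<bar> + 2 * \<bar>norm a - norm b\<bar>) * (Re a + Re b)"
    by (simp add: algebra_simps)
  finally show ?thesis using s by simp
qed

text \<open>
  The shadow retains \<open>v\<close>, hence \<open>norm u = \<phi> v\<close> up to a Lipschitz error, and the imaginary part of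
  \<open>cnj \<alpha> * u\<close>; the preceding estimate recovers its real part.
\<close>

lemma dist_le_dist_shadow:
  assumes \<alpha>: "norm \<alpha> = 1"
    and \<phi>: "\<And>v v'. \<bar>\<phi> v - \<phi> v'\<bar> \<le> dist v v'"
    and p: "p \<in> radial_graph \<phi>" "fst p \<in> sector \<alpha>"
    and q: "q \<in> radial_graph \<phi>" "fst q \<in> sector \<alpha>"
  shows "dist p q \<le> 5 * dist (shadow \<alpha> p) (shadow \<alpha> q)"
proof -
  obtain u v u' v' where pq: "p = (u, v)" "q = (u', v')" by (cases p, cases q)
  let ?d = "dist (shadow \<alpha> p) (shadow \<alpha> q)"
  define a b where ab: "a = cnj \<alpha> * u" "b = cnj \<alpha> * u'"
  have v: "dist v v' \<le> ?d" and x: "\<bar>Im a - Im b\<bar> \<le> ?d"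
    using dist_fst_le[of "shadow \<alpha> p" "shadow \<alpha> q"] dist_snd_le[of "shadow \<alpha> p" "shadow \<alpha> q"]
    by (auto simp: shadow_def pq ab dist_real_def)
  have n: "norm a = \<phi> v" "norm b = \<phi> v'"
    using p q \<alpha> by (auto simp: pq ab radial_graph_def norm_mult)
  have "\<bar>Re a - Re b\<bar> \<le> \<bar>Im a - Im b\<bar> + 2 * \<bar>\<phi> v - \<phi> v'\<bar>"
    using diff_Re_sector_le[of a b] p q unfolding n by (auto simp: pq ab sector_def)
  then have y: "\<bar>Re a - Re b\<bar> \<le> 3 * ?d" using order_trans[OF \<phi> v] x by (smt (verit))
  have "dist u u' = norm (cnj \<alpha> * (u - u'))" using \<alpha> by (simp add: norm_mult dist_norm)
  also have "\<dots> \<le> \<bar>Re a - Re b\<bar> + \<bar>Im a - Im b\<bar>"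
    using cmod_le[of "a - b"] by (simp add: ab right_diff_distrib)
  finally have "dist u u' \<le> 4 * ?d" using x y by linarith
  moreover have "dist p q \<le> dist u u' + dist v v'"
    unfolding pq dist_norm using norm_Pair_le[of "u - u'" "v - v'"] by simp
  ultimately show ?thesis using v by linarith
qed

text \<open>
  With \<open>\<alpha>\<close> the direction of \<open>u0\<close>, the point over \<open>(v, x)\<close> is \<open>u = \<alpha> (y + \<i> x)\<close> with
  \<open>y = sqrt ((\<phi> v)\<^sup>2 - x\<^sup>2)\<close>. It exists when \<open>\<bar>x\<bar> \<le> \<phi> v\<close>, which is why \<open>\<phi>\<close> must be at least \<open>s\<close> on
  the ball, and it is close to \<open>(u0, v0)\<close> because \<open>\<phi> v - \<bar>x\<bar> \<le> y \<le> \<phi> v\<close>.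
\<close>

lemma ball_subset_shadow:
  assumes \<phi>: "\<And>v v'. \<bar>\<phi> v - \<phi> v'\<bar> \<le> dist v v'"
    and p: "(u0, v0) \<in> radial_graph \<phi>"
    and D: "ball v1 s \<subseteq> cball 0 1" and low: "\<And>v. v \<in> ball v1 s \<Longrightarrow> s \<le> \<phi> v"
    and \<rho>: "2 * (dist v0 v1 + 2 * s) \<le> \<rho>"
  obtains \<alpha> where "norm \<alpha> = 1" "ball (v1, 0) s \<subseteq> shadow \<alpha> ` (ball (u0, v0) \<rho> \<inter> radial_graph \<phi>)"
proof -
  obtain \<alpha> where \<alpha>: "norm \<alpha> = 1" "u0 = \<alpha> * of_real (norm u0)"
      by (rule complex_polar[of u0])
  have c\<alpha>: "cnj \<alpha> * (\<alpha> * c) = c" for c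
    using \<alpha>(1) complex_norm_square[of \<alpha>] by (simp add: mult.assoc[symmetric] mult.commute)
  have "ball (v1, 0) s \<subseteq> shadow \<alpha> ` (ball (u0, v0) \<rho> \<inter> radial_graph \<phi>)"
  proof
    fix z assume z: "z \<in> ball (v1, 0::real) s"
    obtain v x where vx: "z = (v, x)" by (cases z)
    have v: "dist v1 v < s" and x: "\<bar>x\<bar> < s"
      using z dist_fst_le[of "(v1, 0)" z] dist_snd_le[of "(v1, 0)" z] by (auto simp: vx dist_real_def)
    have xphi: "\<bar>x\<bar> \<le> \<phi> v" using low[of v] v x by auto
    define y where "y = sqrt ((\<phi> v)\<^sup>2 - x\<^sup>2)"
    have x2: "x\<^sup>2 \<le> (\<phi> v)\<^sup>2" using power_mono[OF xphi, of 2] by simp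
    then have y2: "y\<^sup>2 = (\<phi> v)\<^sup>2 - x\<^sup>2" and y0: "0 \<le> y" by (auto simp: y_def)
    have n: "norm (Complex y x) = \<phi> v"
      using y2 xphi by (simp add: cmod_def)
    have yphi: "\<bar>y - \<phi> v\<bar> \<le> \<bar>x\<bar>"
      using cmod_le[of "Complex y x"] abs_Re_le_cmod[of "Complex y x"] y0 by (simp add: n)
    let ?P = "(\<alpha> * Complex y x, v)"
    have sh: "shadow \<alpha> ?P = z" by (simp add: shadow_def vx c\<alpha>)
    have G: "?P \<in> radial_graph \<phi>"
      using D v \<alpha> by (auto simp: radial_graph_def norm_mult n)
    have nu: "norm u0 = \<phi> v0" using p by (simp add: radial_graph_def)
    have "dist u0 (\<alpha> * Complex y x) = norm (\<alpha> * (of_real (norm u0) - Complex y x))"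
      by (subst \<alpha>(2)) (simp add: dist_norm algebra_simps)
    also have "\<dots> \<le> \<bar>\<phi> v0 - y\<bar> + \<bar>x\<bar>"
      using cmod_le[of "of_real (norm u0) - Complex y x"] \<alpha>(1) unfolding norm_mult nu by simp
    also have "\<dots> \<le> dist v0 v + 2 * \<bar>x\<bar>" using yphi \<phi>[of v0 v] by linarith
    finally have "dist u0 (\<alpha> * Complex y x) \<le> dist v0 v + 2 * \<bar>x\<bar>" .
    moreover have "dist (u0, v0) ?P \<le> dist u0 (\<alpha> * Complex y x) + dist v0 v"
      unfolding dist_norm using norm_Pair_le[of "u0 - \<alpha> * Complex y x" "v0 - v"] by simp
    ultimately have "dist (u0, v0) ?P < \<rho>"
      using dist_triangle[of v0 v v1] v x \<rho> by (smt (verit))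
    then show "z \<in> shadow \<alpha> ` (ball (u0, v0) \<rho> \<inter> radial_graph \<phi>)"
      using sh G by (intro image_eqI[of _ _ ?P]) auto
  qed
  with \<alpha>(1) show ?thesis by (rule that)
qed

section \<open>The boundary of the Hartogs triangle\<close>

lemma closure_hartogs_triangle:
  "closure hartogs_triangle = {(z, w). norm z \<le> norm w \<and> norm w \<le> 1}" (is "_ = ?C")
proof
  have "?C = {p. norm (fst p) \<le> norm (snd p)} \<inter> {p. norm (snd p) \<le> 1}" by auto
  moreover have "closed \<dots>"
    by (intro closed_Int closed_Collect_le continuous_intros)
  ultimately have "closed ?C" by simp
  moreover have "hartogs_triangle \<subseteq> ?C" by (auto simp: hartogs_triangle_def)
  ultimately show "closure hartogs_triangle \<subseteq> ?C" by (rule closure_minimal[rotated])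
next
  show "?C \<subseteq> closure hartogs_triangle"
  proof clarify
    fix z w :: complex assume zw: "norm z \<le> norm w" "norm w \<le> 1"
    obtain \<beta> where \<beta>: "norm \<beta> = 1" "w = \<beta> * of_real (norm w)"
      by (rule complex_polar[of w])
    \<comment> \<open>A segment that moves into the triangle from every point of the closed set, also from \<open>(0, 0)\<close>:
      the modulus of the second coordinate is pulled towards \<open>1 / 2\<close>, that of the first towards 0.\<close>
    define P where "P t = (of_real (1 - t) * z, \<beta> * of_real ((1 - t) * norm w + t / 2))" for t :: real
    have "P t \<in> hartogs_triangle" if "0 < t" "t < 1" for t
    proof -
      have "norm (fst (P t)) = (1 - t) * norm z" "norm (snd (P t)) = (1 - t) * norm w + t / 2"
        using \<beta>(1) that unfolding P_def fst_conv snd_conv norm_mult norm_of_real by auto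
      moreover have "(1 - t) * norm z \<le> (1 - t) * norm w" "(1 - t) * norm w \<le> (1 - t) * 1"
        using zw that by (intro mult_left_mono; simp)+
      ultimately have "norm (fst (P t)) < norm (snd (P t))" "norm (snd (P t)) < 1"
        using that unfolding mult_1_right by linarith+
      then show ?thesis by (auto simp: hartogs_triangle_def case_prod_beta)
    qed
    then have ev: "\<forall>\<^sub>F t in at_right 0. P t \<in> hartogs_triangle"
      by (intro eventually_at_rightI[of 0 1]) auto
    have "(P \<longlongrightarrow> P 0) (at_right 0)" unfolding P_def by (intro tendsto_eq_intros) auto
    moreover have "P 0 = (z, w)" using \<beta>(2) by (simp add: P_def)
    ultimately have "(P \<longlongrightarrow> (z, w)) (at_right 0)" by simp
    then show "(z, w) \<in> closure hartogs_triangle"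
      using ev by (intro Lim_in_closed_set[OF closed_closure]) (auto elim: eventually_mono intro: closure_subset[THEN subsetD])
  qed
qed

lemma frontier_hartogs_triangle:
  "frontier hartogs_triangle = radial_graph norm \<union> prod.swap -` radial_graph (\<lambda>_. 1)"
proof -
  have "hartogs_triangle = {p. norm (fst p) < norm (snd p)} \<inter> {p. norm (snd p) < 1}"
    by (auto simp: hartogs_triangle_def)
  moreover have "open \<dots>"
    by (intro open_Int open_Collect_less continuous_intros)
  ultimately have "open hartogs_triangle" by simp
  then have "frontier hartogs_triangle = closure hartogs_triangle - hartogs_triangle"
    by (simp add: frontier_def interior_open)
  then have "(z, w) \<in> frontier hartogs_triangle \<longleftrightarrow>
      norm z = norm w \<and> norm w \<le> 1 \<or> norm w = 1 \<and> norm z \<le> 1" for z w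
    by (simp add: closure_hartogs_triangle) (simp add: hartogs_triangle_def, linarith)
  then show ?thesis by (simp add: set_eq_iff radial_graph_def)
qed

lemma bounded_diameter_frontier_hartogs_triangle:
  "bounded (frontier hartogs_triangle)" "diameter (frontier hartogs_triangle) \<le> 4"
proof -
  have n: "norm p \<le> 2" if "p \<in> frontier hartogs_triangle" for p
    using that norm_Pair_le[of "fst p" "snd p"]
    by (cases p) (auto simp: frontier_hartogs_triangle radial_graph_def)
  then show "bounded (frontier hartogs_triangle)" unfolding bounded_iff by blast
  show "diameter (frontier hartogs_triangle) \<le> 4"
  proof (rule diameter_le)
    fix p q assume "p \<in> frontier hartogs_triangle" "q \<in> frontier hartogs_triangle"
    then show "norm (p - q) \<le> 4" using n[of p] n[of q] norm_triangle_ineq4[of p q] by linarith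
  qed simp
qed

lemma dist_swap [simp]: "dist (prod.swap p) (prod.swap q) = dist p q"
  by (simp add: dist_prod_def add.commute)

text \<open>
  There are eight pieces, given by one of the two parts of the boundary and one of the four sectors.
  The factor 15 is the product of the distortion 5 of the shadow and the dimension 3.
\<close>

lemma frontier_measure_le:
  assumes "0 < \<rho>"
  shows "hausdorff_measure 3 (ball p \<rho> \<inter> frontier hartogs_triangle)
    \<le> ennreal (8 * unit_ball_vol 3 * 15 ^ 3 * \<rho> ^ 3)"
proof -
  let ?J = "{True, False} \<times> {1, \<i>, -1, -\<i>}"
  define \<sigma> :: "bool \<Rightarrow> complex \<times> complex \<Rightarrow> complex \<times> complex"
    where "\<sigma> b = (if b then id else prod.swap)" for b
  define \<phi> :: "bool \<Rightarrow> complex \<Rightarrow> real" where "\<phi> b = (if b then norm else (\<lambda>_. 1))" for b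
  define f where "f = (\<lambda>(b, \<alpha>) x. shadow \<alpha> (\<sigma> b x))"
  define P where "P = (\<lambda>(b, \<alpha>). {x \<in> ball p \<rho>. \<sigma> b x \<in> radial_graph (\<phi> b) \<and> fst (\<sigma> b x) \<in> sector \<alpha>})"
  have \<sigma>: "dist (\<sigma> b x) (\<sigma> b y) = dist x y" for b x y by (simp add: \<sigma>_def)
  have \<phi>: "\<bar>\<phi> b v - \<phi> b v'\<bar> \<le> dist v v'" for b v v'
    using norm_triangle_ineq3[of v v'] by (simp add: \<phi>_def dist_norm)
  have cov: "ball p \<rho> \<inter> frontier hartogs_triangle \<subseteq> (\<Union>j\<in>?J. P j)"
  proof
    fix x assume x: "x \<in> ball p \<rho> \<inter> frontier hartogs_triangle"
    then have "\<sigma> True x \<in> radial_graph (\<phi> True) \<or> \<sigma> False x \<in> radial_graph (\<phi> False)"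
      by (simp add: frontier_hartogs_triangle \<sigma>_def \<phi>_def)
    then obtain b where b: "\<sigma> b x \<in> radial_graph (\<phi> b)" by blast
    obtain \<alpha> where "\<alpha> \<in> {1, \<i>, -1, -\<i>}" "fst (\<sigma> b x) \<in> sector \<alpha>"
      using sector_cover by blast
    with b x have "(b, \<alpha>) \<in> ?J" "x \<in> P (b, \<alpha>)" by (auto simp: P_def)
    then show "x \<in> (\<Union>j\<in>?J. P j)" by blast
  qed
  have J: "norm (snd j) = 1" if "j \<in> ?J" for j using that by auto
  have "hausdorff_measure DIM(complex \<times> real) (ball p \<rho> \<inter> frontier hartogs_triangle)
     \<le> ennreal (real (card ?J) * (unit_ball_vol (real DIM(complex \<times> real))
          * (5 * real DIM(complex \<times> real) * \<rho>) ^ DIM(complex \<times> real)))"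
  proof (rule hausdorff_measure_le_pieces[where f = f and P = P and q = "\<lambda>j. f j p"])
    fix j x y assume "j \<in> ?J" "x \<in> P j" "y \<in> P j"
    then show "dist x y \<le> 5 * dist (f j x) (f j y)"
      using dist_le_dist_shadow[OF J \<phi>, of j "\<sigma> (fst j) x" "fst j" "\<sigma> (fst j) y"]
      by (simp add: P_def f_def case_prod_beta \<sigma>)
  next
    fix j x assume "j \<in> ?J" "x \<in> P j"
    then show "dist (f j x) (f j p) \<le> \<rho>"
      using dist_shadow_le[OF J, of j "\<sigma> (fst j) x" "\<sigma> (fst j) p"]
      by (simp add: P_def f_def case_prod_beta \<sigma> dist_commute)
  qed (use assms cov in auto)
  then have le: "hausdorff_measure 3 (ball p \<rho> \<inter> frontier hartogs_triangle)
     \<le> ennreal (real (card ?J) * (unit_ball_vol 3 * (5 * 3 * \<rho>) ^ 3))"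
    by (simp only: DIM_prod DIM_complex DIM_real) simp
  have "card ?J \<le> 8"
    using card_insert_le_m1[of 4 "{\<i>, -1, -\<i>}" 1]
    by (simp add: card_cartesian_product card_insert_if)
  then have "real (card ?J) * (unit_ball_vol 3 * (5 * 3 * \<rho>) ^ 3)
      \<le> 8 * (unit_ball_vol 3 * (5 * 3 * \<rho>) ^ 3)"
    using assms by (intro mult_right_mono) auto
  also have "\<dots> = 8 * unit_ball_vol 3 * 15 ^ 3 * \<rho> ^ 3" by (simp add: power_mult_distrib)
  finally show ?thesis using le by (meson ennreal_leI order_trans)
qed

text \<open>
  With \<open>t = \<rho> / 4 < 1\<close>, moving \<open>v\<close> by at most \<open>t\<close> makes room for a ball of radius \<open>t / 8 = \<rho> / 32\<close> in
  the shadow, and \<open>2 * (t + 2 * (t / 8)) \<le> \<rho>\<close> keeps the points above it within distance \<open>\<rho>\<close>.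
\<close>

lemma frontier_measure_ge:
  assumes p: "p \<in> frontier hartogs_triangle" and \<rho>: "0 < \<rho>" "\<rho> < 4"
  shows "ennreal (unit_ball_vol 3 / 64 ^ 3 * \<rho> ^ 3)
    \<le> hausdorff_measure 3 (ball p \<rho> \<inter> frontier hartogs_triangle)"
proof -
  define t where "t = \<rho> / 4"
  have t: "0 < t" "t < 1" "\<rho> = 4 * t" using \<rho> by (auto simp: t_def)
  obtain f :: "complex \<times> complex \<Rightarrow> complex \<times> real" and q
    where lip: "\<And>x y. dist (f x) (f y) \<le> dist x y"
      and sub: "ball q (t / 8) \<subseteq> f ` (ball p \<rho> \<inter> frontier hartogs_triangle)"
  proof (cases "p \<in> radial_graph norm")
    case True
    obtain z w where zw: "p = (z, w)" by (cases p)
    obtain \<beta> where \<beta>: "norm \<beta> = 1" "w = \<beta> * of_real (norm w)"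
      by (rule complex_polar[of w])
    \<comment> \<open>Pulling the modulus of \<open>w\<close> towards \<open>1 / 2\<close> leaves distance at least \<open>t / 2\<close> both to the apex 0 and
      to the edge \<open>norm w = 1\<close> of the cone.\<close>
    define r where "r = (1 - t) * norm w + t / 2"
    define v1 where "v1 = \<beta> * of_real r"
    have w1: "norm w \<le> 1" using True by (simp add: zw radial_graph_def)
    have r: "t / 2 \<le> r" "r \<le> 1 - t / 2"
    proof -
      have "0 \<le> (1 - t) * norm w" "(1 - t) * norm w \<le> (1 - t) * 1"
        using t w1 by (auto intro!: mult_left_mono simp del: mult_cancel_left)
      then show "t / 2 \<le> r" "r \<le> 1 - t / 2" by (auto simp: r_def)
    qed
    have nv: "norm v1 = r" using \<beta> r t by (simp add: v1_def norm_mult)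
    have "dist w v1 = norm (\<beta> * of_real (norm w - r))"
      unfolding v1_def dist_norm by (subst \<beta>(2)) (simp add: algebra_simps)
    also have "\<dots> = \<bar>norm w - r\<bar>" unfolding norm_mult norm_of_real \<beta>(1) by simp
    also have "norm w - r = t * (norm w - 1 / 2)" by (simp add: r_def algebra_simps)
    also have "\<bar>\<dots>\<bar> = t * \<bar>norm w - 1 / 2\<bar>" using t by (simp add: abs_mult)
    also have "\<dots> \<le> t * (1 / 2)"
      using w1 t norm_ge_zero[of w] by (intro mult_left_mono) (auto simp: abs_if)
    finally have d: "dist w v1 \<le> t / 2" by simp
    have near: "\<bar>norm v - r\<bar> \<le> t / 8" if "v \<in> ball v1 (t / 8)" for v
      using that norm_triangle_ineq3[of v v1] by (simp add: nv dist_norm norm_minus_commute)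
    obtain \<alpha> where "norm \<alpha> = 1" "ball (v1, 0) (t / 8) \<subseteq> shadow \<alpha> ` (ball (z, w) \<rho> \<inter> radial_graph norm)"
    proof (rule ball_subset_shadow[of norm z w v1 "t / 8" \<rho>])
      show "\<bar>norm v - norm v'\<bar> \<le> dist v v'" for v v' :: complex
        by (simp add: dist_norm norm_triangle_ineq3)
      show "ball v1 (t / 8) \<subseteq> cball 0 1" 
      proof
        fix v assume "v \<in> ball v1 (t / 8)"
        then have "norm v \<le> 1" using near[of v] r t by linarith
        then show "v \<in> cball 0 1" by simp
      qed
      show "t / 8 \<le> norm v" if "v \<in> ball v1 (t / 8)" for v using near[OF that] r t by linarith
    qed (use True zw d t in auto)
    then show ?thesis
      using that[of "shadow \<alpha>"] dist_shadow_le unfolding frontier_hartogs_triangle zw by blast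
  next
    case False
    obtain z w where zw: "p = (z, w)" by (cases p)
    have S2: "(w, z) \<in> radial_graph (\<lambda>_. 1)"
      using False p by (auto simp: zw frontier_hartogs_triangle)
    then have z1: "norm z \<le> 1" by (simp add: radial_graph_def)
    \<comment> \<open>Here only the edge \<open>norm z = 1\<close> has to be avoided.\<close>
    define v1 where "v1 = of_real (1 - t) * z"
    have "norm v1 = (1 - t) * norm z" unfolding v1_def norm_mult norm_of_real using t by simp
    then have nv: "norm v1 \<le> 1 - t" using t z1 mult_left_mono[of "norm z" 1 "1 - t"] by simp
    have "z - v1 = of_real t * z" by (simp add: v1_def algebra_simps)
    then have d: "dist z v1 \<le> t"
      using t z1 mult_left_mono[of "norm z" 1 t] by (simp add: dist_norm norm_mult)
    obtain \<alpha> where \<alpha>: "norm \<alpha> = 1"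
      and sub: "ball (v1, 0) (t / 8) \<subseteq> shadow \<alpha> ` (ball (w, z) \<rho> \<inter> radial_graph (\<lambda>_. 1))"
    proof (rule ball_subset_shadow[of "\<lambda>_. 1" w z v1 "t / 8" \<rho>])
      show "ball v1 (t / 8) \<subseteq> cball 0 1"
      proof
        fix v assume "v \<in> ball v1 (t / 8)"
        then show "v \<in> cball 0 1"
          using nv t norm_triangle_sub[of v v1] by (simp add: dist_norm norm_minus_commute)
      qed
    qed (use S2 d t in auto)
    have "ball (w, z) \<rho> \<inter> radial_graph (\<lambda>_. 1) \<subseteq> prod.swap ` (ball p \<rho> \<inter> frontier hartogs_triangle)"
    proof
      fix x assume "x \<in> ball (w, z) \<rho> \<inter> radial_graph (\<lambda>_. 1)"
      then have "prod.swap x \<in> ball p \<rho> \<inter> frontier hartogs_triangle"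
        using dist_swap[of "(w, z)" x] by (auto simp: zw frontier_hartogs_triangle)
      then show "x \<in> prod.swap ` (ball p \<rho> \<inter> frontier hartogs_triangle)"
        by (intro image_eqI[of _ _ "prod.swap x"]) auto
    qed
    then have "ball (v1, 0) (t / 8) \<subseteq> (shadow \<alpha> \<circ> prod.swap) ` (ball p \<rho> \<inter> frontier hartogs_triangle)"
      using sub unfolding image_comp[symmetric] by blast
    then show ?thesis
      using that[of "shadow \<alpha> \<circ> prod.swap"] dist_shadow_le[OF \<alpha>] by (metis comp_apply dist_swap)
  qed
  have "ennreal (unit_ball_vol (real DIM(complex \<times> real)) * (t / 8 / 2) ^ DIM(complex \<times> real))
      \<le> hausdorff_measure DIM(complex \<times> real) (ball p \<rho> \<inter> frontier hartogs_triangle)"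
    by (rule hausdorff_measure_ge_ball[OF lip _ sub]) (use t in simp)
  moreover have "unit_ball_vol (real DIM(complex \<times> real)) * (t / 8 / 2) ^ DIM(complex \<times> real)
      = unit_ball_vol 3 / 64 ^ 3 * \<rho> ^ 3"
    by (simp add: t_def power_divide)
  moreover have "DIM(complex \<times> real) = 3" by simp
  ultimately show ?thesis by metis
qed

theorem lemma2p9:
  shows "ahlfors_david_regular (frontier hartogs_triangle)"
proof -
  define b where "b = unit_ball_vol 3 / 64 ^ 3"
  define B where "B = 8 * unit_ball_vol 3 * 15 ^ 3"
  have pos: "0 < b" "0 < B" by (auto simp: b_def B_def unit_ball_vol_pos)
  define c where "c = inverse b + B"
  have c: "0 < c" "B \<le> c" using pos by (auto simp: c_def add_pos_pos)
  have "inverse c \<le> inverse (inverse b)" using pos by (intro le_imp_inverse_le) (auto simp: c_def)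
  then have cb: "inverse c \<le> b" by simp
  have "ennreal (inverse c * \<rho> ^ 3) \<le> hausdorff_measure 3 (ball p \<rho> \<inter> frontier hartogs_triangle)
      \<and> hausdorff_measure 3 (ball p \<rho> \<inter> frontier hartogs_triangle) \<le> ennreal (c * \<rho> ^ 3)"
    if "p \<in> frontier hartogs_triangle" "0 < \<rho>"
      "bounded (frontier hartogs_triangle) \<longrightarrow> \<rho> < diameter (frontier hartogs_triangle)" for p \<rho>
  proof -
    have "\<rho> < 4" using that bounded_diameter_frontier_hartogs_triangle by linarith
    then have lo: "ennreal (b * \<rho> ^ 3) \<le> hausdorff_measure 3 (ball p \<rho> \<inter> frontier hartogs_triangle)"
      using frontier_measure_ge that by (simp add: b_def)
    have hi: "hausdorff_measure 3 (ball p \<rho> \<inter> frontier hartogs_triangle) \<le> ennreal (B * \<rho> ^ 3)"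
      using frontier_measure_le[OF that(2)] by (simp add: B_def)
    have "inverse c * \<rho> ^ 3 \<le> b * \<rho> ^ 3" "B * \<rho> ^ 3 \<le> c * \<rho> ^ 3"
      using cb c that by (auto intro!: mult_right_mono)
    then show ?thesis using lo hi by (meson ennreal_leI order_trans)
  qed
  then show ?thesis
    unfolding ahlfors_david_regular_def using c by (auto simp: frontier_closed intro!: exI[of _ c])
qed

end
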